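(* There is a finite exchange complex $X$ on seven vertices, with vertex set $\{0,1,\dots,6\}$ and complexity $c$ the identity on $\{0,1,\dots,6\}$, whose descending link at the top vertex $6$ is contractible but is not a cone.
   Context: A simplicial complex is flag if every finite clique of its $1$-skeleton spans a simplex. For vertices $u,w$ at edge-path distance $2$, $I(u,w)$ is the set of common neighbours; $x\in I(u,w)$ is an apex if it is equal or adjacent to every member of $I(u,w)$. An exchange complex is a pair $(X,c)$ with $X$ a non-empty connected flag simplicial complex and $c\colon X^{(0)}\to W$ a map (the complexity) to a well-ordered set such that (N1) $I(u,w)$ has an apex whenever $\mathrm{dist}(u,w)=2$, and (N2) whenever $\mathrm{dist}(u,w)=2$, some apex $x$ of $I(u,w)$ satisfies $c(x)<\max\{c(u),c(w)\}$. The descending link at $v$ is the full subcomplex of $X$ on $\{u: u\text{ adjacent to }v,\ c(u)<c(v)\}$. A flag complex is a cone if it has a vertex adjacent to all its other vertices. *)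

theory Defs
  imports "HOL-Analysis.Analysis" "HOL-Library.Extended_Nat"
begin

text \<open>Simplices are non-empty finite sets of vertices; the empty simplex is excluded.\<close>

definition abstract_simplicial_complex :: "'a set set \<Rightarrow> bool" where
  "abstract_simplicial_complex X \<longleftrightarrow>
     (\<forall>\<sigma>\<in>X. finite \<sigma> \<and> \<sigma> \<noteq> {}) \<and> (\<forall>\<sigma>\<in>X. \<forall>\<tau>. \<tau> \<subseteq> \<sigma> \<and> \<tau> \<noteq> {} \<longrightarrow> \<tau> \<in> X)"

definition vertices :: "'a set set \<Rightarrow> 'a set" where
  "vertices X = \<Union>X"

definition adjacent :: "'a set set \<Rightarrow> 'a \<Rightarrow> 'a \<Rightarrow> bool" where
  "adjacent X u w \<longleftrightarrow> u \<noteq> w \<and> {u, w} \<in> X"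

definition edge_rel :: "'a set set \<Rightarrow> ('a \<times> 'a) set" where
  "edge_rel X = {(u, w). adjacent X u w}"

definition flag_complex :: "'a set set \<Rightarrow> bool" where
  "flag_complex X \<longleftrightarrow> abstract_simplicial_complex X \<and>
     (\<forall>K. finite K \<and> K \<noteq> {} \<and> K \<subseteq> vertices X \<and>
          (\<forall>u\<in>K. \<forall>w\<in>K. u \<noteq> w \<longrightarrow> adjacent X u w) \<longrightarrow> K \<in> X)"

definition connected_complex :: "'a set set \<Rightarrow> bool" where
  "connected_complex X \<longleftrightarrow> (\<forall>u\<in>vertices X. \<forall>w\<in>vertices X. (u, w) \<in> (edge_rel X)\<^sup>*)"

text \<open>The distance is the least length of an edge path, and \<open>\<infinity>\<close> if there is none.\<close>

definition edge_dist :: "'a set set \<Rightarrow> 'a \<Rightarrow> 'a \<Rightarrow> enat" where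
  "edge_dist X u w = (INF n\<in>{n. (u, w) \<in> edge_rel X ^^ n}. enat n)"

definition common_neighbours :: "'a set set \<Rightarrow> 'a \<Rightarrow> 'a \<Rightarrow> 'a set" where
  "common_neighbours X u w = {x. adjacent X u x \<and> adjacent X w x}"

definition apex :: "'a set set \<Rightarrow> 'a \<Rightarrow> 'a \<Rightarrow> 'a \<Rightarrow> bool" where
  "apex X u w x \<longleftrightarrow> x \<in> common_neighbours X u w \<and>
     (\<forall>y\<in>common_neighbours X u w. x = y \<or> adjacent X x y)"

text \<open>The well-ordered set of complexities is a type of class \<open>wellorder\<close>; only the values
  of \<open>c\<close> on the vertices matter.\<close>

definition exchange_complex :: "'a set set \<Rightarrow> ('a \<Rightarrow> 'w::wellorder) \<Rightarrow> bool" where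
  "exchange_complex X c \<longleftrightarrow>
     flag_complex X \<and> X \<noteq> {} \<and> connected_complex X \<and>
     (\<forall>u\<in>vertices X. \<forall>w\<in>vertices X. edge_dist X u w = 2 \<longrightarrow> (\<exists>x. apex X u w x)) \<and>
     (\<forall>u\<in>vertices X. \<forall>w\<in>vertices X. edge_dist X u w = 2 \<longrightarrow>
        (\<exists>x. apex X u w x \<and> c x < max (c u) (c w)))"

definition full_subcomplex :: "'a set set \<Rightarrow> 'a set \<Rightarrow> 'a set set" where
  "full_subcomplex X S = {\<sigma>\<in>X. \<sigma> \<subseteq> S}"

definition descending_link :: "'a set set \<Rightarrow> ('a \<Rightarrow> 'w::wellorder) \<Rightarrow> 'a \<Rightarrow> 'a set set" where
  "descending_link X c v = full_subcomplex X {u. adjacent X u v \<and> c u < c v}"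

definition is_cone :: "'a set set \<Rightarrow> bool" where
  "is_cone K \<longleftrightarrow> (\<exists>v\<in>vertices K. \<forall>u\<in>vertices K. u \<noteq> v \<longrightarrow> adjacent K v u)"

text \<open>Points of the geometric realization are given by barycentric coordinates. A closed cell
  carries the subspace topology of the product topology on \<open>'a \<Rightarrow> real\<close>, which is Euclidean since
  \<open>\<sigma>\<close> is finite; the realization carries the weak topology determined by its closed cells.\<close>

definition closed_cell :: "'a set \<Rightarrow> ('a \<Rightarrow> real) set" where
  "closed_cell \<sigma> = {f. (\<forall>v. 0 \<le> f v) \<and> (\<forall>v. v \<notin> \<sigma> \<longrightarrow> f v = 0) \<and> (\<Sum>v\<in>\<sigma>. f v) = 1}"

definition geometric_realization :: "'a set set \<Rightarrow> ('a \<Rightarrow> real) topology" where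
  "geometric_realization K = topology (\<lambda>U. U \<subseteq> (\<Union>\<sigma>\<in>K. closed_cell \<sigma>) \<and>
     (\<forall>\<sigma>\<in>K. openin (top_of_set (closed_cell \<sigma>)) (U \<inter> closed_cell \<sigma>)))"

lemma openin_geometric_realization:
  "openin (geometric_realization K) U \<longleftrightarrow> U \<subseteq> (\<Union>\<sigma>\<in>K. closed_cell \<sigma>) \<and>
     (\<forall>\<sigma>\<in>K. openin (top_of_set (closed_cell \<sigma>)) (U \<inter> closed_cell \<sigma>))"
proof -
  have "istopology (\<lambda>U. U \<subseteq> (\<Union>\<sigma>\<in>K. closed_cell \<sigma>) \<and>
     (\<forall>\<sigma>\<in>K. openin (top_of_set (closed_cell \<sigma>)) (U \<inter> closed_cell \<sigma>)))" (is "istopology ?P")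
    unfolding istopology_def
  proof (intro conjI allI impI)
    fix S T assume S: "?P S" and T: "?P T"
    show "S \<inter> T \<subseteq> (\<Union>\<sigma>\<in>K. closed_cell \<sigma>)" using S by blast
    show "\<forall>\<sigma>\<in>K. openin (top_of_set (closed_cell \<sigma>)) (S \<inter> T \<inter> closed_cell \<sigma>)"
    proof
      fix \<sigma> assume "\<sigma> \<in> K"
      then have "openin (top_of_set (closed_cell \<sigma>)) ((S \<inter> closed_cell \<sigma>) \<inter> (T \<inter> closed_cell \<sigma>))"
        using S T by (meson openin_Int)
      moreover have "(S \<inter> closed_cell \<sigma>) \<inter> (T \<inter> closed_cell \<sigma>) = S \<inter> T \<inter> closed_cell \<sigma>" by blast
      ultimately show "openin (top_of_set (closed_cell \<sigma>)) (S \<inter> T \<inter> closed_cell \<sigma>)" by simp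
    qed
  next
    fix \<U> assume U: "\<forall>S\<in>\<U>. ?P S"
    show "\<Union>\<U> \<subseteq> (\<Union>\<sigma>\<in>K. closed_cell \<sigma>)" using U by blast
    show "\<forall>\<sigma>\<in>K. openin (top_of_set (closed_cell \<sigma>)) (\<Union>\<U> \<inter> closed_cell \<sigma>)"
    proof
      fix \<sigma> assume "\<sigma> \<in> K"
      then have "openin (top_of_set (closed_cell \<sigma>)) (\<Union>S\<in>\<U>. S \<inter> closed_cell \<sigma>)"
        using U by (intro openin_Union) blast
      moreover have "(\<Union>S\<in>\<U>. S \<inter> closed_cell \<sigma>) = \<Union>\<U> \<inter> closed_cell \<sigma>" by blast
      ultimately show "openin (top_of_set (closed_cell \<sigma>)) (\<Union>\<U> \<inter> closed_cell \<sigma>)" by simp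
    qed
  qed
  then show ?thesis
    unfolding geometric_realization_def by (simp add: topology_inverse')
qed

lemma topspace_geometric_realization:
  "topspace (geometric_realization K) = (\<Union>\<sigma>\<in>K. closed_cell \<sigma>)"
proof (rule subset_antisym)
  show "topspace (geometric_realization K) \<subseteq> (\<Union>\<sigma>\<in>K. closed_cell \<sigma>)"
    using openin_topspace[of "geometric_realization K"]
    unfolding openin_geometric_realization by blast
  have "openin (geometric_realization K) (\<Union>\<sigma>\<in>K. closed_cell \<sigma>)"
    unfolding openin_geometric_realization
  proof (intro conjI ballI subset_refl)
    fix \<sigma> assume "\<sigma> \<in> K"
    then have "(\<Union>\<sigma>\<in>K. closed_cell \<sigma>) \<inter> closed_cell \<sigma> = closed_cell \<sigma>" by blast
    then show "openin (top_of_set (closed_cell \<sigma>)) ((\<Union>\<sigma>\<in>K. closed_cell \<sigma>) \<inter> closed_cell \<sigma>)"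
      by simp
  qed
  then show "(\<Union>\<sigma>\<in>K. closed_cell \<sigma>) \<subseteq> topspace (geometric_realization K)"
    by (rule openin_subset)
qed

text \<open>The predicate \<open>contractible_space\<close> holds of the empty space, which is excluded here.\<close>

definition contractible_complex :: "'a set set \<Rightarrow> bool" where
  "contractible_complex K \<longleftrightarrow> K \<noteq> {} \<and> contractible_space (geometric_realization K)"

end

theory Submission
  imports Defs
begin

text \<open>The complex is the cone, with apex \<open>6\<close>, over the \<open>3\<close>-sun: a triangle \<open>0, 1, 2\<close> together with
  three tips \<open>3, 4, 5\<close>, where the tip \<open>i + 3\<close> is joined to the two corners other than \<open>i\<close>. The apex
  sees every vertex, so it lies in every \<open>I(u,w)\<close>, and any exchange vertex of complexity below \<open>6\<close>
  must itself be found in the sun. The sun allows this because it has diameter two although no vertex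
  is adjacent to all the others: two tips share exactly one corner, and a tip and its opposite corner
  share the two remaining corners, which are adjacent. Every non-adjacent pair contains a tip, and
  corners have smaller complexity than tips, so these common neighbours satisfy both exchange
  conditions.

  The descending link at \<open>6\<close> is the sun. It is not a cone, since each corner misses a tip and no two
  tips are adjacent. It is contractible because folding each tip onto one of its corners is a
  simplicial map that is contiguous to the identity (the closed neighbourhood of a tip lies in
  that of the corner, lemma \<open>contractible_clique_complex_if_dominated\<close>) and that has image in the
  triangle; two straight-line homotopies, from the identity to the fold and from the fold to a
  corner, contract the realization (lemma \<open>contractible_complex_if_contiguous_to_identity\<close>). Since
  the complex is finite, the weak topology is the subspace topology, and the continuity of these
  homotopies can be read off coordinate by coordinate.\<close>

section \<open>Realizations of finite complexes\<close>

lemma closed_closed_cell: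
  assumes "finite \<sigma>"
  shows "closed (closed_cell \<sigma>)"
proof -
  have "closed_cell \<sigma> =
      (\<Inter>v. {f. 0 \<le> f v}) \<inter> (\<Inter>v\<in>-\<sigma>. {f. f v = 0}) \<inter> {f. (\<Sum>v\<in>\<sigma>. f v) = 1}"
    by (auto simp: closed_cell_def)
  moreover have "closed (\<Inter>v. {f :: 'a \<Rightarrow> real. 0 \<le> f v})"
    by (intro closed_INT ballI closed_Collect_le continuous_intros
        continuous_on_product_coordinates)
  moreover have "closed (\<Inter>v\<in>-\<sigma>. {f :: 'a \<Rightarrow> real. f v = 0})"
    by (intro closed_INT ballI closed_Collect_eq continuous_intros
        continuous_on_product_coordinates)
  moreover have "closed {f :: 'a \<Rightarrow> real. (\<Sum>v\<in>\<sigma>. f v) = 1}"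
    by (intro closed_Collect_eq continuous_intros continuous_on_product_coordinates)
  ultimately show ?thesis
    by (simp add: closed_Int)
qed

text \<open>A set that meets every cell in a closed set is a finite union of closed sets, because the cells
  themselves are closed; so the weak topology adds no closed sets to the subspace topology.\<close>

lemma geometric_realization_finite:
  assumes "finite K" and fin: "\<forall>\<sigma>\<in>K. finite \<sigma>"
  shows "geometric_realization K = top_of_set (\<Union>\<sigma>\<in>K. closed_cell \<sigma>)"
proof -
  let ?S = "\<Union>\<sigma>\<in>K. closed_cell \<sigma>"
  have "openin (geometric_realization K) U \<longleftrightarrow> openin (top_of_set ?S) U" for U
  proof
    assume U: "openin (geometric_realization K) U"
    have "closed (closed_cell \<sigma> - U)" if "\<sigma> \<in> K" for \<sigma>
    proof -
      have "openin (top_of_set (closed_cell \<sigma>)) (U \<inter> closed_cell \<sigma>)"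
        using U that by (auto simp: openin_geometric_realization)
      then have "closedin (top_of_set (closed_cell \<sigma>)) (closed_cell \<sigma> - U \<inter> closed_cell \<sigma>)"
        by (metis closedin_diff closedin_topspace topspace_euclidean_subtopology)
      then have "closed (closed_cell \<sigma> - U \<inter> closed_cell \<sigma>)"
        using closed_closed_cell[OF bspec[OF fin that]] closedin_closed_trans by blast
      moreover have "closed_cell \<sigma> - U \<inter> closed_cell \<sigma> = closed_cell \<sigma> - U"
        by blast
      ultimately show ?thesis by simp
    qed
    then have "closed (\<Union>\<sigma>\<in>K. (closed_cell \<sigma> - U))"
      using \<open>finite K\<close> by (intro closed_UN) auto
    then have "open (- (\<Union>\<sigma>\<in>K. (closed_cell \<sigma> - U)))"
      by (rule open_Compl)
    moreover have "U = ?S \<inter> - (\<Union>\<sigma>\<in>K. (closed_cell \<sigma> - U))"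
      using U by (auto simp: openin_geometric_realization)
    ultimately show "openin (top_of_set ?S) U"
      by (metis openin_open)
  next
    assume "openin (top_of_set ?S) U"
    then obtain T where T: "open T" "U = ?S \<inter> T"
      by (auto simp: openin_open)
    then have "U \<inter> closed_cell \<sigma> = closed_cell \<sigma> \<inter> T" if "\<sigma> \<in> K" for \<sigma>
      using that by blast
    then show "openin (geometric_realization K) U"
      using T by (auto simp: openin_geometric_realization openin_open)
  qed
  then show ?thesis
    by (simp add: topology_eq)
qed

lemma continuous_map_into_geometric_realization:
  assumes "finite K" "\<forall>\<sigma>\<in>K. finite \<sigma>"
  shows "continuous_map Z (geometric_realization K) f \<longleftrightarrow>
    (\<forall>v. continuous_map Z euclideanreal (\<lambda>z. f z v)) \<and>
    (\<forall>z\<in>topspace Z. \<exists>\<sigma>\<in>K. f z \<in> closed_cell \<sigma>)"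
  unfolding geometric_realization_finite[OF assms] continuous_map_in_subtopology
    euclidean_product_topology[symmetric] continuous_map_componentwise_UNIV
  by (auto simp: Pi_iff image_subset_iff)

lemma closed_cell_mono:
  assumes "finite \<tau>" "\<sigma> \<subseteq> \<tau>"
  shows "closed_cell \<sigma> \<subseteq> closed_cell \<tau>"
proof
  fix f assume f: "f \<in> closed_cell \<sigma>"
  then have "(\<Sum>v\<in>\<tau>. f v) = (\<Sum>v\<in>\<sigma>. f v)"
    using assms by (intro sum.mono_neutral_right) (auto simp: closed_cell_def)
  then show "f \<in> closed_cell \<tau>"
    using f assms by (auto simp: closed_cell_def)
qed

lemma closed_cell_convex_combination:
  fixes t :: real
  assumes "f \<in> closed_cell \<sigma>" "g \<in> closed_cell \<sigma>" "0 \<le> t" "t \<le> 1"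
  shows "(\<lambda>v. (1 - t) * f v + t * g v) \<in> closed_cell \<sigma>"
  using assms by (auto simp: closed_cell_def sum.distrib simp flip: sum_distrib_left)

text \<open>The straight-line homotopy stays in the realization because cells are convex.\<close>

lemma homotopic_with_if_common_cell:
  assumes K: "finite K" "\<forall>\<sigma>\<in>K. finite \<sigma>"
    and f: "continuous_map Z (geometric_realization K) f"
    and g: "continuous_map Z (geometric_realization K) g"
    and cell: "\<And>z. z \<in> topspace Z \<Longrightarrow> \<exists>\<sigma>\<in>K. f z \<in> closed_cell \<sigma> \<and> g z \<in> closed_cell \<sigma>"
  shows "homotopic_with (\<lambda>_. True) Z (geometric_realization K) f g"
proof -
  let ?I = "top_of_set {0..1::real}"
  let ?h = "\<lambda>(t, z) v. (1 - t) * f z v + t * g z v"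
  have coord: "continuous_map (prod_topology ?I Z) euclideanreal (\<lambda>p. k (snd p) v)"
    if "continuous_map Z (geometric_realization K) k" for k v
    using that continuous_map_compose[OF continuous_map_snd, of Z euclideanreal "\<lambda>z. k z v"]
    by (auto simp: continuous_map_into_geometric_realization[OF K] o_def)
  have time: "continuous_map (prod_topology ?I Z) euclideanreal fst"
    using continuous_map_fst continuous_map_into_fulltopology by blast
  have "continuous_map (prod_topology ?I Z) (geometric_realization K) ?h"
    unfolding continuous_map_into_geometric_realization[OF K]
  proof (intro conjI allI ballI)
    fix v
    have "continuous_map (prod_topology ?I Z) euclideanreal
        (\<lambda>p. (1 - fst p) * f (snd p) v + fst p * g (snd p) v)"
      by (intro continuous_intros coord f g time)
    then show "continuous_map (prod_topology ?I Z) euclideanreal (\<lambda>p. ?h p v)"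
      by (simp add: case_prod_unfold)
  next
    fix p assume "p \<in> topspace (prod_topology ?I Z)"
    then show "\<exists>\<sigma>\<in>K. ?h p \<in> closed_cell \<sigma>"
      using cell closed_cell_convex_combination by (fastforce simp: case_prod_unfold)
  qed
  then show ?thesis
    unfolding homotopic_with_def by (intro exI[of _ ?h]) auto
qed

section \<open>Simplicial maps contiguous to the identity\<close>

text \<open>The affine extension of a vertex map \<open>\<phi>\<close>: the weight of \<open>u\<close> is carried to \<open>\<phi> u\<close>.\<close>

definition realize_map :: "'a set \<Rightarrow> ('a \<Rightarrow> 'a) \<Rightarrow> ('a \<Rightarrow> real) \<Rightarrow> 'a \<Rightarrow> real" where
  "realize_map V \<phi> f w = (\<Sum>u\<in>{u \<in> V. \<phi> u = w}. f u)"

lemma realize_map_in_closed_cell: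
  assumes "finite V" "\<sigma> \<subseteq> V" "f \<in> closed_cell \<sigma>"
  shows "realize_map V \<phi> f \<in> closed_cell (\<phi> ` \<sigma>)"
proof -
  have \<sigma>: "finite \<sigma>" using assms finite_subset by blast
  have eq: "realize_map V \<phi> f w = (\<Sum>u\<in>{u \<in> \<sigma>. \<phi> u = w}. f u)" for w
    unfolding realize_map_def
    using assms by (intro sum.mono_neutral_right) (auto simp: closed_cell_def)
  have "(\<Sum>w\<in>\<phi> ` \<sigma>. realize_map V \<phi> f w) = (\<Sum>u\<in>\<sigma>. f u)"
    unfolding eq by (rule sum.image_gen[OF \<sigma>, symmetric])
  moreover have "realize_map V \<phi> f w = 0" if "w \<notin> \<phi> ` \<sigma>" for w
  proof -
    have "{u \<in> \<sigma>. \<phi> u = w} = {}" using that by blast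
    then show ?thesis by (simp only: eq sum.empty)
  qed
  ultimately show ?thesis
    using assms by (auto simp: closed_cell_def realize_map_def intro: sum_nonneg)
qed

text \<open>A point and its image under \<open>\<phi>\<close> lie in the common cell \<open>\<sigma> \<union> \<phi> ` \<sigma>\<close>, so \<open>\<phi>\<close> is homotopic to the
  identity; the image of \<open>\<phi>\<close> lies in a single cell, in which it can be contracted to a vertex.\<close>

lemma contractible_complex_if_contiguous_to_identity:
  assumes "finite K" and fin: "\<forall>\<sigma>\<in>K. finite \<sigma>"
    and contiguous: "\<And>\<sigma>. \<sigma> \<in> K \<Longrightarrow> \<sigma> \<union> \<phi> ` \<sigma> \<in> K"
    and image: "\<phi> ` vertices K \<in> K" and nonempty: "vertices K \<noteq> {}"
  shows "contractible_complex K"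
proof -
  let ?G = "geometric_realization K"
  let ?V = "vertices K"
  let ?r = "realize_map ?V \<phi>"
  have V: "finite ?V"
    using \<open>finite K\<close> fin by (auto simp: vertices_def)
  have subV: "\<sigma> \<subseteq> ?V" if "\<sigma> \<in> K" for \<sigma>
    using that by (auto simp: vertices_def)
  have common: "f \<in> closed_cell (\<sigma> \<union> \<phi> ` \<sigma>) \<and> ?r f \<in> closed_cell (\<sigma> \<union> \<phi> ` \<sigma>)"
    if "\<sigma> \<in> K" "f \<in> closed_cell \<sigma>" for \<sigma> f
    using that fin realize_map_in_closed_cell[OF V subV[OF that(1)] that(2), of \<phi>]
      closed_cell_mono[of "\<sigma> \<union> \<phi> ` \<sigma>" \<sigma>] closed_cell_mono[of "\<sigma> \<union> \<phi> ` \<sigma>" "\<phi> ` \<sigma>"]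
    by auto
  have in_image: "?r f \<in> closed_cell (\<phi> ` ?V)" if "\<sigma> \<in> K" "f \<in> closed_cell \<sigma>" for \<sigma> f
    using realize_map_in_closed_cell[OF V subV[OF that(1)] that(2), of \<phi>]
      closed_cell_mono[OF finite_imageI[OF V] image_mono[OF subV[OF that(1)]], of \<phi>]
    by blast
  note into = continuous_map_into_geometric_realization[OF \<open>finite K\<close> fin]
  have id: "continuous_map ?G ?G id" by simp
  then have coord: "continuous_map ?G euclideanreal (\<lambda>f. f v)" for v
    unfolding into by simp
  have r: "continuous_map ?G ?G ?r"
    unfolding into
  proof (intro conjI allI ballI)
    show "continuous_map ?G euclideanreal (\<lambda>f. ?r f v)" for v
      unfolding realize_map_def using V by (intro continuous_map_sum coord) auto
    show "\<exists>\<sigma>\<in>K. ?r f \<in> closed_cell \<sigma>" if "f \<in> topspace ?G" for f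
      using that in_image image by (auto simp: topspace_geometric_realization)
  qed
  obtain a where a: "a \<in> ?V" using nonempty by blast
  define e :: "'a \<Rightarrow> real" where "e = (\<lambda>v. if v = \<phi> a then 1 else 0)"
  have e: "e \<in> closed_cell (\<phi> ` ?V)"
    using a V by (auto simp: e_def closed_cell_def)
  then have const: "continuous_map ?G ?G (\<lambda>_. e)"
    using image by (auto simp: topspace_geometric_realization)
  have "homotopic_with (\<lambda>_. True) ?G ?G id ?r"
  proof (rule homotopic_with_if_common_cell[OF \<open>finite K\<close> fin id r])
    fix f assume "f \<in> topspace ?G"
    then obtain \<sigma> where "\<sigma> \<in> K" "f \<in> closed_cell \<sigma>"
      by (auto simp: topspace_geometric_realization)
    then show "\<exists>\<sigma>\<in>K. id f \<in> closed_cell \<sigma> \<and> ?r f \<in> closed_cell \<sigma>"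
      using common contiguous by (metis id_apply)
  qed
  moreover have "homotopic_with (\<lambda>_. True) ?G ?G ?r (\<lambda>_. e)"
    by (rule homotopic_with_if_common_cell[OF \<open>finite K\<close> fin r const])
      (use in_image image e in \<open>auto simp: topspace_geometric_realization\<close>)
  ultimately have "homotopic_with (\<lambda>_. True) ?G ?G id (\<lambda>_. e)"
    by (rule homotopic_with_trans)
  then show ?thesis
    using image by (auto simp: contractible_complex_def contractible_space_def)
qed

section \<open>Clique complexes\<close>

definition clique_complex :: "'a set \<Rightarrow> ('a \<Rightarrow> 'a \<Rightarrow> bool) \<Rightarrow> 'a set set" where
  "clique_complex V E =
     {\<sigma>. finite \<sigma> \<and> \<sigma> \<noteq> {} \<and> \<sigma> \<subseteq> V \<and> (\<forall>u\<in>\<sigma>. \<forall>w\<in>\<sigma>. u \<noteq> w \<longrightarrow> E u w)}"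

lemma finite_clique_complex: "finite V \<Longrightarrow> finite (clique_complex V E)"
  by (rule finite_subset[of _ "Pow V"]) (auto simp: clique_complex_def)

lemma vertices_clique_complex [simp]: "vertices (clique_complex V E) = V"
proof
  show "V \<subseteq> vertices (clique_complex V E)"
  proof
    fix v assume "v \<in> V"
    then have "{v} \<in> clique_complex V E" by (simp add: clique_complex_def)
    then show "v \<in> vertices (clique_complex V E)" by (auto simp: vertices_def)
  qed
qed (auto simp: vertices_def clique_complex_def)

lemma adjacent_clique_complex:
  assumes "symp E"
  shows "adjacent (clique_complex V E) u w \<longleftrightarrow> u \<noteq> w \<and> u \<in> V \<and> w \<in> V \<and> E u w"
  using assms by (auto simp: adjacent_def clique_complex_def dest: sympD)

lemma flag_clique_complex:
  assumes "symp E"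
  shows "flag_complex (clique_complex V E)"
  unfolding flag_complex_def abstract_simplicial_complex_def
    adjacent_clique_complex[OF assms] vertices_clique_complex
  by (auto simp: clique_complex_def intro: finite_subset)

lemma full_subcomplex_clique_complex:
  "S \<subseteq> V \<Longrightarrow> full_subcomplex (clique_complex V E) S = clique_complex S E"
  by (auto simp: full_subcomplex_def clique_complex_def)

text \<open>Domination of every vertex \<open>u\<close> by \<open>\<phi> u\<close> makes \<open>\<phi>\<close> contiguous to the identity: replacing the
  vertices of a clique by their images one end of an edge at a time keeps them pairwise equal or
  adjacent.\<close>

lemma contractible_clique_complex_if_dominated:
  assumes "finite V" "V \<noteq> {}" "symp E" and maps: "\<phi> ` V \<subseteq> V"
    and dominated: "\<And>u w. u \<in> V \<Longrightarrow> w \<in> V \<Longrightarrow> u = w \<or> E u w \<Longrightarrow> \<phi> u = w \<or> E (\<phi> u) w"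
    and clique: "\<And>u w. u \<in> V \<Longrightarrow> w \<in> V \<Longrightarrow> \<phi> u = \<phi> w \<or> E (\<phi> u) (\<phi> w)"
  shows "contractible_complex (clique_complex V E)"
proof (rule contractible_complex_if_contiguous_to_identity)
  show "finite (clique_complex V E)"
    using \<open>finite V\<close> by (rule finite_clique_complex)
  show "\<phi> ` vertices (clique_complex V E) \<in> clique_complex V E"
    using assms(1,2) maps clique
    unfolding vertices_clique_complex by (auto simp: clique_complex_def)
  show "vertices (clique_complex V E) \<noteq> {}" using \<open>V \<noteq> {}\<close> by simp
  show "\<forall>\<sigma>\<in>clique_complex V E. finite \<sigma>"
    by (simp add: clique_complex_def)
  show "\<sigma> \<union> \<phi> ` \<sigma> \<in> clique_complex V E" if \<sigma>: "\<sigma> \<in> clique_complex V E" for \<sigma>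
  proof -
    have pair: "\<phi> u = w \<or> (E (\<phi> u) w \<and> E w (\<phi> u))" if "u \<in> \<sigma>" "w \<in> \<sigma>" for u w
    proof -
      have "u = w \<or> E u w" "u \<in> V" "w \<in> V"
        using \<sigma> that by (auto simp: clique_complex_def)
      then show ?thesis using dominated \<open>symp E\<close> by (metis sympD)
    qed
    have "E x y" if "x \<in> \<sigma> \<union> \<phi> ` \<sigma>" "y \<in> \<sigma> \<union> \<phi> ` \<sigma>" "x \<noteq> y" for x y
    proof -
      have "\<sigma> \<subseteq> V" using \<sigma> by (simp add: clique_complex_def)
      then have "E x y" if "x \<in> \<phi> ` \<sigma>" "y \<in> \<phi> ` \<sigma>"
        using that \<open>x \<noteq> y\<close> clique by blast
      moreover have "E x y" if "x \<in> \<sigma>" "y \<in> \<sigma>"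
        using that \<open>x \<noteq> y\<close> \<sigma> by (simp add: clique_complex_def)
      ultimately show ?thesis
        using that pair by blast
    qed
    moreover have "\<sigma> \<union> \<phi> ` \<sigma> \<subseteq> V" "finite \<sigma>" "\<sigma> \<noteq> {}"
      using \<sigma> maps by (auto simp: clique_complex_def)
    ultimately show ?thesis
      by (simp add: clique_complex_def)
  qed
qed

section \<open>Exchange complexes with a universal vertex\<close>

lemma edge_dist_eq_2_imp_not_adjacent:
  assumes "edge_dist X u w = 2"
  shows "u \<noteq> w" "\<not> adjacent X u w"
proof -
  have le: "edge_dist X u w \<le> enat n" if "(u, w) \<in> edge_rel X ^^ n" for n
    using that unfolding edge_dist_def by (auto intro: INF_lower)
  have "\<not> (2 :: enat) \<le> enat n" if "n \<le> 1" for n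
    using that by (simp add: numeral_eq_enat)
  then have no: "(u, w) \<notin> edge_rel X ^^ n" if "n \<le> 1" for n
    using le that assms by metis
  show "u \<noteq> w" using no[of 0] by auto
  show "\<not> adjacent X u w" using no[of 1] by (auto simp: edge_rel_def)
qed

lemma apex_iff:
  "apex X u w x \<longleftrightarrow> adjacent X u x \<and> adjacent X w x \<and>
    (\<forall>y\<in>vertices X. adjacent X u y \<and> adjacent X w y \<longrightarrow> x = y \<or> adjacent X x y)"
  by (auto simp: apex_def common_neighbours_def adjacent_def vertices_def)

lemma exchange_complex_if_universal_vertex:
  assumes "flag_complex X" and a: "a \<in> vertices X"
    and universal: "\<And>u. u \<in> vertices X \<Longrightarrow> u \<noteq> a \<Longrightarrow> adjacent X u a"
    and exchange: "\<And>u w. u \<in> vertices X \<Longrightarrow> w \<in> vertices X \<Longrightarrow> u \<noteq> w \<Longrightarrow> \<not> adjacent X u w \<Longrightarrow>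
      \<exists>x. apex X u w x \<and> c x < max (c u) (c w)"
  shows "exchange_complex X c"
proof -
  have "(u, a) \<in> (edge_rel X)\<^sup>* \<and> (a, u) \<in> (edge_rel X)\<^sup>*" if "u \<in> vertices X" for u
    using universal[OF that] by (cases "u = a") (auto simp: edge_rel_def adjacent_def insert_commute)
  then have "connected_complex X"
    unfolding connected_complex_def by (meson rtrancl_trans)
  moreover have "X \<noteq> {}" using a by (auto simp: vertices_def)
  moreover have "\<exists>x. apex X u w x \<and> c x < max (c u) (c w)"
    if "u \<in> vertices X" "w \<in> vertices X" "edge_dist X u w = 2" for u w
    using that exchange edge_dist_eq_2_imp_not_adjacent by metis
  ultimately show ?thesis
    using \<open>flag_complex X\<close> unfolding exchange_complex_def by blast
qed

section \<open>The cone over the sun\<close>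

text \<open>On \<open>{0..5}\<close> this is the \<open>3\<close>-sun, given by its non-edges: the pairs of tips, and each tip with its
  opposite corner. The vertex \<open>6\<close> is joined to everything.\<close>

definition sun_cone_edge :: "nat \<Rightarrow> nat \<Rightarrow> bool" where
  "sun_cone_edge u w \<longleftrightarrow> {u, w} \<notin> {{3, 4}, {3, 5}, {4, 5}, {0, 3}, {1, 4}, {2, 5}}"

lemma symp_sun_cone_edge: "symp sun_cone_edge"
  by (auto simp: symp_def sun_cone_edge_def insert_commute)

lemmas sun_cone_simps = adjacent_clique_complex[OF symp_sun_cone_edge] sun_cone_edge_def
  doubleton_eq_iff

lemma atLeastAtMost_0_6: "{0..6} = {0, 1, 2, 3, 4, 5, 6 :: nat}"
  by auto

lemma exchange_complex_sun_cone:
  "exchange_complex (clique_complex {0..6} sun_cone_edge) (id :: nat \<Rightarrow> nat)"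
proof (rule exchange_complex_if_universal_vertex[of _ 6])
  let ?X = "clique_complex {0..6} sun_cone_edge"
  show "flag_complex ?X"
    by (rule flag_clique_complex[OF symp_sun_cone_edge])
  show "6 \<in> vertices ?X" by simp
  show "adjacent ?X u 6" if "u \<in> vertices ?X" "u \<noteq> 6" for u
    using that by (auto simp: sun_cone_simps)
  show "\<exists>x. apex ?X u w x \<and> id x < max (id u) (id w)"
    if "u \<in> vertices ?X" "w \<in> vertices ?X" "u \<noteq> w" "\<not> adjacent ?X u w" for u w
  proof -
    let ?pair = "\<lambda>i j. u = i \<and> w = j \<or> u = j \<and> w = i"
    have "?pair 3 4 \<or> ?pair 3 5 \<or> ?pair 4 5 \<or> ?pair 0 3 \<or> ?pair 1 4 \<or> ?pair 2 5"
      using that by (simp add: sun_cone_simps)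
    \<comment> \<open>Two tips exchange through their shared corner, a tip and its opposite corner through either
      of the other corners.\<close>
    moreover have "apex ?X u w 2" if "?pair 3 4 \<or> ?pair 1 4"
      using that by (elim disjE conjE; simp add: apex_iff sun_cone_simps atLeastAtMost_0_6)
    moreover have "apex ?X u w 1" if "?pair 3 5 \<or> ?pair 0 3 \<or> ?pair 2 5"
      using that by (elim disjE conjE; simp add: apex_iff sun_cone_simps atLeastAtMost_0_6)
    moreover have "apex ?X u w 0" if "?pair 4 5"
      using that by (elim disjE conjE; simp add: apex_iff sun_cone_simps atLeastAtMost_0_6)
    ultimately show ?thesis by (elim disjE) (auto intro: exI)
  qed
qed

lemma descending_link_sun_cone:
  "descending_link (clique_complex {0..6} sun_cone_edge) (id :: nat \<Rightarrow> nat) 6 =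
    clique_complex {0..5} sun_cone_edge"
proof -
  have "{u. adjacent (clique_complex {0..6} sun_cone_edge) u 6 \<and> id u < (id 6 :: nat)} = {0..5}"
    by (auto simp: sun_cone_simps)
  then show ?thesis
    by (simp add: descending_link_def full_subcomplex_clique_complex)
qed

lemma atLeastAtMost_0_5: "{0..5} = {0, 1, 2, 3, 4, 5 :: nat}"
  by auto

lemma contractible_sun: "contractible_complex (clique_complex {0..5} sun_cone_edge)"
proof (rule contractible_clique_complex_if_dominated[where \<phi> = "id(3 := 1, 4 := 2, 5 := 0)"])
  let ?\<phi> = "id(3 := 1, 4 := 2, 5 := 0) :: nat \<Rightarrow> nat"
  have "\<forall>u\<in>{0..5}. \<forall>w\<in>{0..5}.
      u = w \<or> sun_cone_edge u w \<longrightarrow> ?\<phi> u = w \<or> sun_cone_edge (?\<phi> u) w"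
    by (simp add: sun_cone_edge_def doubleton_eq_iff atLeastAtMost_0_5)
  then show "?\<phi> u = w \<or> sun_cone_edge (?\<phi> u) w"
    if "u \<in> {0..5}" "w \<in> {0..5}" "u = w \<or> sun_cone_edge u w" for u w
    using that by blast
  have "\<forall>u\<in>{0..5}. \<forall>w\<in>{0..5}. ?\<phi> u = ?\<phi> w \<or> sun_cone_edge (?\<phi> u) (?\<phi> w)"
    by (simp add: sun_cone_edge_def doubleton_eq_iff atLeastAtMost_0_5)
  then show "?\<phi> u = ?\<phi> w \<or> sun_cone_edge (?\<phi> u) (?\<phi> w)"
    if "u \<in> {0..5}" "w \<in> {0..5}" for u w
    using that by blast
qed (auto simp: symp_sun_cone_edge)

lemma not_cone_sun: "\<not> is_cone (clique_complex {0..5} sun_cone_edge)"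
  by (simp add: is_cone_def sun_cone_simps atLeastAtMost_0_5)

theorem proposition7p2:
  "\<exists>X :: nat set set.
     finite X \<and> vertices X = {0..6} \<and> exchange_complex X (id :: nat \<Rightarrow> nat) \<and>
     contractible_complex (descending_link X (id :: nat \<Rightarrow> nat) 6) \<and>
     \<not> is_cone (descending_link X (id :: nat \<Rightarrow> nat) 6)"
proof (intro exI conjI)
  let ?X = "clique_complex {0..6} sun_cone_edge"
  show "finite ?X" by (simp add: finite_clique_complex)
  show "vertices ?X = {0..6}" by simp
  show "exchange_complex ?X (id :: nat \<Rightarrow> nat)" by (rule exchange_complex_sun_cone)
  show "contractible_complex (descending_link ?X (id :: nat \<Rightarrow> nat) 6)"
    by (simp only: descending_link_sun_cone contractible_sun)
  show "\<not> is_cone (descending_link ?X (id :: nat \<Rightarrow> nat) 6)"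
    by (simp only: descending_link_sun_cone not_cone_sun not_False_eq_True)
qed

end
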